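(* Let $G=\langle a,t\mid t^2=1,\ atat=tata\rangle$, with generating set $\Sigma=\{a,t\}$ (so $\Sigma\cup\Sigma^{-1}=\{a,a^{-1},t\}$). For any of the orderings $a<a^{-1}<t$, $\ a^{-1}<a<t$, $\ t<a<a^{-1}$, $\ t<a^{-1}<a$ of $\{a,a^{-1},t\}$, the group $G$ has the shortlex falsification by fellow traveller property (SL-FFTP) with respect to $\Sigma$.
   Context: $\Sigma\cup\Sigma^{-1}=\{a,a^{-1},t\}$ is regarded as a subset of $G$ (note $t^{-1}=t$), and $\{a,a^{-1},t\}^*$ is the set of finite words over it; $|w|$ is the length of a word $w$, and $w=_Gv$ means that $w$ and $v$ represent the same element of $G$. Shortlex order. For words $w_1,w_2$ over a totally ordered alphabet $(S,<)$: $w_1<_{\mathrm{lex}}w_2$ iff $w_1$ is a strict prefix of $w_2$ or, in the first position where they differ, the letter of $w_1$ is smaller than that of $w_2$; $w_1<_{\mathrm{SL}}w_2$ iff $|w_1|<|w_2|$, or $|w_1|=|w_2|$ and $w_1<_{\mathrm{lex}}w_2$. For $g\in G$, $\mathrm{SL}(g)$ is the $<_{\mathrm{SL}}$-minimal word representing $g$, and $\mathrm{SL}_G=\{\mathrm{SL}(g):g\in G\}$. Fellow travelling. A word $w=s_1\cdots s_n$ determines the path in the Cayley graph of $G$ with respect to $\Sigma$ with vertices $v_0=1_G$, $v_i=s_1\cdots s_i$. For $K\ge 0$, two paths with vertex sequences $v_0,\dots,v_n$ and $u_0,\dots,u_m$ asynchronously $K$-fellow travel if there are non-decreasing maps $f:\{0,\dots,n\}\to\{0,\dots,m\}$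 and $g:\{0,\dots,m\}\to\{0,\dots,n\}$ such that $d(v_i,u_{f(i)})\le K$ for all $i$ and $d(u_j,v_{g(j)})\le K$ for all $j$, where $d$ is the graph distance. Two words asynchronously $K$-fellow travel if their paths starting at $1_G$ do. SL-FFTP. $G$ has SL-FFTP with respect to $\Sigma$ (and the order $<$ on $\Sigma\cup\Sigma^{-1}$) if there is a constant $K\ge0$ such that for every word $w\in(\Sigma\cup\Sigma^{-1})^*$ with $w\notin\mathrm{SL}_G$ there is a word $v\in(\Sigma\cup\Sigma^{-1})^*$ that asynchronously $K$-fellow travels with $w$ and satisfies $w=_Gv$ and $v<_{\mathrm{SL}}w$. *)

theory Defs
  imports "HOL-Algebra.Generated_Groups"
begin

section \<open>Group presentations\<close>

text \<open>
  A signed letter is a pair \<open>(x, e)\<close> standing for \<open>x\<close> if \<open>e\<close> is \<open>True\<close> and for the formal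
  inverse of \<open>x\<close> otherwise. The generators of a presentation are all elements of the type
  \<open>'g\<close>, and a relation \<open>u = v\<close> is the pair \<open>(u, v)\<close> of signed words.
\<close>

type_synonym 'g signed_word = "('g \<times> bool) list"

inductive pres_eq :: "('g signed_word \<times> 'g signed_word) set \<Rightarrow> 'g signed_word \<Rightarrow> 'g signed_word \<Rightarrow> bool"
  for R where
  rel: "(u, v) \<in> R \<Longrightarrow> pres_eq R u v"
| cancel: "pres_eq R [(x, e), (x, \<not> e)] []"
| refl: "pres_eq R u u"
| sym: "pres_eq R u v \<Longrightarrow> pres_eq R v u"
| trans: "pres_eq R u v \<Longrightarrow> pres_eq R v w \<Longrightarrow> pres_eq R u w"
| app: "pres_eq R u u' \<Longrightarrow> pres_eq R v v' \<Longrightarrow> pres_eq R (u @ v) (u' @ v')"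

definition pres_class :: "('g signed_word \<times> 'g signed_word) set \<Rightarrow> 'g signed_word \<Rightarrow> 'g signed_word set" where
  "pres_class R u = {v. pres_eq R u v}"

definition presented_group :: "('g signed_word \<times> 'g signed_word) set \<Rightarrow> 'g signed_word set monoid" where
  "presented_group R =
     \<lparr>carrier = range (pres_class R),
      mult = (\<lambda>A B. \<Union>u\<in>A. \<Union>v\<in>B. pres_class R (u @ v)),
      one = pres_class R []\<rparr>"

lemma pres_class_eq_iff: "pres_class R u = pres_class R v \<longleftrightarrow> pres_eq R u v"
proof
  assume "pres_class R u = pres_class R v"
  moreover have "v \<in> pres_class R v" by (simp add: pres_class_def pres_eq.refl)
  ultimately have "v \<in> pres_class R u" by blast
  then show "pres_eq R u v" by (simp add: pres_class_def)
next
  assume "pres_eq R u v"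
  then have "pres_eq R u w \<longleftrightarrow> pres_eq R v w" for w
    using pres_eq.sym[of R u v] pres_eq.trans[of R u v w] pres_eq.trans[of R v u w] by blast
  then show "pres_class R u = pres_class R v"
    by (simp add: pres_class_def)
qed

lemma presented_group_carrier: "carrier (presented_group R) = range (pres_class R)"
  and presented_group_one: "\<one>\<^bsub>presented_group R\<^esub> = pres_class R []"
  by (simp_all add: presented_group_def)

lemma presented_group_mult:
  "pres_class R u \<otimes>\<^bsub>presented_group R\<^esub> pres_class R v = pres_class R (u @ v)"
proof -
  have eq: "pres_class R (u' @ v') = pres_class R (u @ v)"
    if "u' \<in> pres_class R u" "v' \<in> pres_class R v" for u' v'
  proof -
    have "pres_eq R (u @ v) (u' @ v')"
      using that by (intro pres_eq.app) (simp_all add: pres_class_def)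
    then show ?thesis using pres_class_eq_iff by blast
  qed
  have "u \<in> pres_class R u" "v \<in> pres_class R v"
    by (simp_all add: pres_class_def pres_eq.refl)
  then have "(\<Union>u'\<in>pres_class R u. \<Union>v'\<in>pres_class R v. pres_class R (u' @ v')) = pres_class R (u @ v)"
    using eq by blast
  then show ?thesis by (simp add: presented_group_def)
qed

definition inv_word :: "'g signed_word \<Rightarrow> 'g signed_word" where
  "inv_word u = rev (map (\<lambda>(x, e). (x, \<not> e)) u)"

lemma pres_eq_inv_word: "pres_eq R (inv_word u @ u) []"
proof (induction u)
  case Nil
  then show ?case by (simp add: inv_word_def pres_eq.refl)
next
  case (Cons p u)
  obtain x e where p: "p = (x, e)" by (cases p)
  have "pres_eq R ([(x, \<not> e), (x, e)] @ u) ([] @ u)"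
    using pres_eq.cancel[of R x "\<not> e"] by (intro pres_eq.app pres_eq.refl) simp
  then have "pres_eq R (inv_word u @ ([(x, \<not> e), (x, e)] @ u)) (inv_word u @ u)"
    by (intro pres_eq.app pres_eq.refl) simp
  then have "pres_eq R (inv_word u @ ([(x, \<not> e), (x, e)] @ u)) []"
    using Cons by (rule pres_eq.trans)
  then show ?case by (simp add: inv_word_def p)
qed

lemma presented_group_group: "group (presented_group R)"
proof (rule groupI)
  fix x assume "x \<in> carrier (presented_group R)"
  then obtain u where "x = pres_class R u" by (auto simp: presented_group_carrier)
  then have "pres_class R (inv_word u) \<otimes>\<^bsub>presented_group R\<^esub> x = \<one>\<^bsub>presented_group R\<^esub>"
    by (simp add: presented_group_one presented_group_mult pres_class_eq_iff pres_eq_inv_word)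
  then show "\<exists>y\<in>carrier (presented_group R). y \<otimes>\<^bsub>presented_group R\<^esub> x = \<one>\<^bsub>presented_group R\<^esub>"
    by (auto simp: presented_group_carrier)
qed (auto simp: presented_group_carrier presented_group_one presented_group_mult)

lemma presented_group_inv: "inv\<^bsub>presented_group R\<^esub> (pres_class R u) = pres_class R (inv_word u)"
proof -
  interpret group "presented_group R" by (rule presented_group_group)
  show ?thesis
    by (rule inv_equality)
       (auto simp: presented_group_carrier presented_group_one presented_group_mult
         pres_class_eq_iff pres_eq_inv_word)
qed


section \<open>Words over a generating set and the Cayley graph\<close>

text \<open>Here \<open>\<Sigma>\<close> is a subset of the carrier; formal inverses are identified with inverses in \<open>G\<close>.\<close>

definition letters :: "('a, 'b) monoid_scheme \<Rightarrow> 'a set \<Rightarrow> 'a set" where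
  "letters G \<Sigma> = \<Sigma> \<union> m_inv G ` \<Sigma>"

definition word_val :: "('a, 'b) monoid_scheme \<Rightarrow> 'a list \<Rightarrow> 'a" where
  "word_val G w = foldr (mult G) w \<one>\<^bsub>G\<^esub>"

definition cayley_edges :: "('a, 'b) monoid_scheme \<Rightarrow> 'a set \<Rightarrow> ('a \<times> 'a) set" where
  "cayley_edges G \<Sigma> = {(g, g \<otimes>\<^bsub>G\<^esub> s) | g s. g \<in> carrier G \<and> s \<in> letters G \<Sigma>}"

text \<open>
  Graph distance: the least length of an edge path. The value is meaningful only for vertices
  joined by a path, which is every pair of vertices if \<open>\<Sigma>\<close> generates \<open>G\<close>.
\<close>

definition cayley_dist :: "('a, 'b) monoid_scheme \<Rightarrow> 'a set \<Rightarrow> 'a \<Rightarrow> 'a \<Rightarrow> nat" where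
  "cayley_dist G \<Sigma> g h = (LEAST n. (g, h) \<in> cayley_edges G \<Sigma> ^^ n)"

definition path_vertex :: "('a, 'b) monoid_scheme \<Rightarrow> 'a list \<Rightarrow> nat \<Rightarrow> 'a" where
  "path_vertex G w i = word_val G (take i w)"

definition async_fellow_travel ::
    "('a, 'b) monoid_scheme \<Rightarrow> 'a set \<Rightarrow> nat \<Rightarrow> 'a list \<Rightarrow> 'a list \<Rightarrow> bool" where
  "async_fellow_travel G \<Sigma> K w v \<longleftrightarrow>
     (\<exists>f g. f \<in> {0..length w} \<rightarrow> {0..length v} \<and> mono_on {0..length w} f \<and>
            g \<in> {0..length v} \<rightarrow> {0..length w} \<and> mono_on {0..length v} g \<and>
            (\<forall>i\<in>{0..length w}. cayley_dist G \<Sigma> (path_vertex G w i) (path_vertex G v (f i)) \<le> K) \<and>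
            (\<forall>j\<in>{0..length v}. cayley_dist G \<Sigma> (path_vertex G v j) (path_vertex G w (g j)) \<le> K))"


section \<open>Shortlex normal forms and SL-FFTP\<close>

text \<open>
  A strict total order on the letters is given by the set \<open>r\<close> of pairs \<open>(x, y)\<close> with
  \<open>x < y\<close>. The shortlex order on words is then \<open>lenlex r\<close>:
\<close>

lemma lenlex_iff_shortlex:
  "(u, v) \<in> lenlex r \<longleftrightarrow>
     length u < length v \<or> length u = length v \<and> (u, v) \<in> lexord r"
  by (auto simp: lenlex_conv lexord_lex)

definition SL :: "('a, 'b) monoid_scheme \<Rightarrow> 'a set \<Rightarrow> ('a \<times> 'a) set \<Rightarrow> 'a \<Rightarrow> 'a list" where
  "SL G \<Sigma> r g = (THE w. w \<in> lists (letters G \<Sigma>) \<and> word_val G w = g \<and>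
     (\<forall>v\<in>lists (letters G \<Sigma>). word_val G v = g \<longrightarrow> v = w \<or> (w, v) \<in> lenlex r))"

definition SL_set :: "('a, 'b) monoid_scheme \<Rightarrow> 'a set \<Rightarrow> ('a \<times> 'a) set \<Rightarrow> 'a list set" where
  "SL_set G \<Sigma> r = SL G \<Sigma> r ` carrier G"

definition SL_FFTP :: "('a, 'b) monoid_scheme \<Rightarrow> 'a set \<Rightarrow> ('a \<times> 'a) set \<Rightarrow> bool" where
  "SL_FFTP G \<Sigma> r \<longleftrightarrow>
     (\<exists>K. \<forall>w\<in>lists (letters G \<Sigma>). w \<notin> SL_set G \<Sigma> r \<longrightarrow>
        (\<exists>v\<in>lists (letters G \<Sigma>). async_fellow_travel G \<Sigma> K w v \<and>
           word_val G w = word_val G v \<and> (v, w) \<in> lenlex r))"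

text \<open>The strict order in which the entries of a duplicate-free list increase from left to right.\<close>

definition list_order :: "'a list \<Rightarrow> ('a \<times> 'a) set" where
  "list_order xs = {(xs ! i, xs ! j) | i j. i < j \<and> j < length xs}"


section \<open>The group \<open>\<langle>a, t | t\<^sup>2 = 1, atat = tata\<rangle>\<close>\<close>

datatype gen = A | T

definition G_rels :: "(gen signed_word \<times> gen signed_word) set" where
  "G_rels =
     {([(T, True), (T, True)], []),
      ([(A, True), (T, True), (A, True), (T, True)], [(T, True), (A, True), (T, True), (A, True)])}"

definition G_at :: "gen signed_word set monoid" where
  "G_at = presented_group G_rels"

definition a_G :: "gen signed_word set" where
  "a_G = pres_class G_rels [(A, True)]"

definition t_G :: "gen signed_word set" where
  "t_G = pres_class G_rels [(T, True)]"

lemma G_at_group: "group G_at"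
  by (simp add: G_at_def presented_group_group)

lemma a_G_carrier: "a_G \<in> carrier G_at" and t_G_carrier: "t_G \<in> carrier G_at"
  by (auto simp: G_at_def presented_group_carrier a_G_def t_G_def)

lemma inv_a_G: "inv\<^bsub>G_at\<^esub> a_G = pres_class G_rels [(A, False)]"
  by (simp add: G_at_def a_G_def presented_group_inv inv_word_def)

lemma inv_t_G: "inv\<^bsub>G_at\<^esub> t_G = t_G"
proof -
  interpret group G_at by (rule G_at_group)
  have "pres_eq G_rels [(T, True), (T, True)] []"
    by (rule pres_eq.rel) (simp add: G_rels_def)
  then have "t_G \<otimes>\<^bsub>G_at\<^esub> t_G = \<one>\<^bsub>G_at\<^esub>"
    by (simp add: G_at_def t_G_def presented_group_mult presented_group_one pres_class_eq_iff)
  then show ?thesis by (simp add: inv_equality t_G_carrier)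
qed

lemma letters_G_at: "letters G_at {a_G, t_G} = {a_G, inv\<^bsub>G_at\<^esub> a_G, t_G}"
  by (auto simp: letters_def inv_t_G)

lemma G_at_generated: "generate G_at {a_G, t_G} = carrier G_at"
proof
  interpret group G_at by (rule G_at_group)
  show "generate G_at {a_G, t_G} \<subseteq> carrier G_at"
    by (rule generate_incl) (simp add: a_G_carrier t_G_carrier)
  have "pres_class G_rels u \<in> generate G_at {a_G, t_G}" for u
  proof (induction u)
    case Nil
    show ?case
      using generate.one[of G_at "{a_G, t_G}"] by (simp add: G_at_def presented_group_one)
  next
    case (Cons p u)
    have "pres_class G_rels [p] \<in> {a_G, t_G, inv\<^bsub>G_at\<^esub> a_G, inv\<^bsub>G_at\<^esub> t_G}"
    proof (cases p)
      case (Pair x e)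
      have "inv\<^bsub>G_at\<^esub> t_G = pres_class G_rels [(T, False)]"
        by (simp add: G_at_def t_G_def presented_group_inv inv_word_def)
      then show ?thesis
        unfolding Pair inv_a_G by (cases x; cases e) (auto simp: a_G_def t_G_def)
    qed
    then have "pres_class G_rels [p] \<in> generate G_at {a_G, t_G}"
      by (auto intro: generate.incl generate.inv)
    then have "pres_class G_rels [p] \<otimes>\<^bsub>G_at\<^esub> pres_class G_rels u \<in> generate G_at {a_G, t_G}"
      using Cons by (rule generate.eng)
    then show ?case
      by (simp add: G_at_def presented_group_mult)
  qed
  then show "carrier G_at \<subseteq> generate G_at {a_G, t_G}"
    by (auto simp: G_at_def presented_group_carrier)
qed

text \<open>
  The exponent sum of \<open>a\<close> is \<open>1\<close>, \<open>-1\<close> and \<open>0\<close> on the three letters; they are therefore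
  distinct, so that a listing of them does define a strict total order.
\<close>

definition a_exp :: "gen signed_word \<Rightarrow> int" where
  "a_exp u = sum_list (map (\<lambda>(x, e). if x = A then if e then 1 else - 1 else 0) u)"

lemma pres_eq_G_rels_a_exp:
  assumes "pres_eq G_rels u v"
  shows "a_exp u = a_exp v"
  using assms by (induction rule: pres_eq.induct) (auto simp: a_exp_def G_rels_def)

lemma letters_distinct: "distinct [a_G, inv\<^bsub>G_at\<^esub> a_G, t_G]"
proof -
  have "\<not> pres_eq G_rels [(A, True)] [(A, False)]" "\<not> pres_eq G_rels [(A, True)] [(T, True)]"
    "\<not> pres_eq G_rels [(A, False)] [(T, True)]"
    using pres_eq_G_rels_a_exp by (fastforce simp: a_exp_def)+
  then show ?thesis
    unfolding inv_a_G by (simp add: a_G_def t_G_def pres_class_eq_iff)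
qed

end

theory Submission
  imports Defs
begin

text \<open>
  Conjugation by any word takes \<open>a\<^sup>\<plusminus>\<^sup>1\<close> to \<open>a\<^sup>\<plusminus>\<^sup>1\<close> or \<open>t a\<^sup>\<plusminus>\<^sup>1 t\<close>, and \<open>a\<close> commutes with \<open>t a t\<close>.
  So a letter \<open>s = a\<^sup>\<plusminus>\<^sup>1\<close> can be moved across a subword \<open>q = t a\<^sup>k t\<close>, and the paths of \<open>p s q r\<close> and
  \<open>p q s r\<close> stay at bounded distance, however long \<open>q\<close> is. When \<open>t\<close> is the least letter one moves
  \<open>s\<close> to the right, when \<open>t\<close> is the greatest one moves it to the left. A freely reduced word to
  which no such move applies is one of \<open>a\<^sup>m\<close>, \<open>a\<^sup>m t a\<^sup>n\<close> and \<open>t a\<^sup>n t a\<^sup>m\<close> (respectively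
  \<open>a\<^sup>m t a\<^sup>n t\<close>) with \<open>n \<noteq> 0\<close> in the last case. These words are told apart by the homomorphism
  onto \<open>\<int>\<^sup>2 \<rtimes> \<int>/2\<close>, hence they are the shortlex normal forms.
\<close>

section \<open>Distances and fellow travelling in a group\<close>

context group
begin

context
  fixes \<Sigma> :: "'a set"
  assumes \<Sigma>: "\<Sigma> \<subseteq> carrier G"
begin

lemma letters_carrier: "letters G \<Sigma> \<subseteq> carrier G"
  using \<Sigma> by (auto simp: letters_def)

lemma inv_letters: "s \<in> letters G \<Sigma> \<Longrightarrow> inv s \<in> letters G \<Sigma>"
  using \<Sigma> by (auto simp: letters_def subset_iff)

lemma word_val_closed [simp]: "u \<in> lists (letters G \<Sigma>) \<Longrightarrow> word_val G u \<in> carrier G"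
  using letters_carrier by (induction u) (auto simp: word_val_def)

lemma word_val_Nil: "word_val G [] = \<one>"
  and word_val_Cons: "word_val G (s # u) = s \<otimes> word_val G u"
  by (simp_all add: word_val_def)

lemma word_val_append:
  assumes "u \<in> lists (letters G \<Sigma>)" "v \<in> lists (letters G \<Sigma>)"
  shows "word_val G (u @ v) = word_val G u \<otimes> word_val G v"
  using assms
proof (induction u)
  case (Cons s u)
  then have "s \<in> carrier G" using letters_carrier by auto
  with Cons show ?case by (simp add: word_val_Cons m_assoc)
qed (simp add: word_val_Nil)

lemma take_in_lists: "u \<in> lists S \<Longrightarrow> take i u \<in> lists S"
  by (auto dest: in_set_takeD)

text \<open>Keeping the length is what makes \<open>near\<close> symmetric with an unchanged
  constant.\<close>

lemma ex_inverse_word: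
  assumes "u \<in> lists (letters G \<Sigma>)"
  shows "\<exists>v\<in>lists (letters G \<Sigma>). length v = length u \<and> word_val G v = inv (word_val G u)"
  using assms
proof (induction u)
  case Nil
  show ?case by (rule bexI[of _ "[]"]) (simp_all add: word_val_Nil)
next
  case (Cons s u)
  then obtain v where v: "v \<in> lists (letters G \<Sigma>)" "length v = length u"
    "word_val G v = inv (word_val G u)" by auto
  have s: "s \<in> carrier G" "inv s \<in> letters G \<Sigma>"
    using Cons letters_carrier inv_letters by auto
  have "word_val G (v @ [inv s]) = inv (word_val G (s # u))"
    using s v Cons by (simp add: word_val_append word_val_Cons word_val_Nil inv_mult_group)
  then show ?case
    using s v by (intro bexI[of _ "v @ [inv s]"]) auto
qed

lemma cayley_dist_le:
  assumes "g \<in> carrier G" "u \<in> lists (letters G \<Sigma>)"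
  shows "cayley_dist G \<Sigma> g (g \<otimes> word_val G u) \<le> length u"
proof -
  have "(g, g \<otimes> word_val G u) \<in> cayley_edges G \<Sigma> ^^ length u"
    using assms
  proof (induction u arbitrary: g)
    case Nil
    then show ?case by (simp add: word_val_Nil)
  next
    case (Cons s u)
    then have s: "s \<in> letters G \<Sigma>" "s \<in> carrier G" using letters_carrier by auto
    have "(g, g \<otimes> s) \<in> cayley_edges G \<Sigma>"
      using s Cons by (auto simp: cayley_edges_def)
    moreover have "(g \<otimes> s, g \<otimes> word_val G (s # u)) \<in> cayley_edges G \<Sigma> ^^ length u"
      using Cons.IH[of "g \<otimes> s"] Cons.prems s by (simp add: word_val_Cons m_assoc)
    ultimately show ?case
      by (simp only: list.size(4) add_Suc_right add_0_right) (rule relpow_Suc_I2)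
  qed
  then show ?thesis unfolding cayley_dist_def by (rule Least_le)
qed

text \<open>Closeness is witnessed by an explicit word, which can be inverted and extended.
  \<open>near_cayley_dist\<close> turns such a witness into a bound on the distance, which is a
  \<open>LEAST\<close> and awkward to handle directly.\<close>

definition near :: "nat \<Rightarrow> 'a \<Rightarrow> 'a \<Rightarrow> bool" where
  "near K g h \<longleftrightarrow> (\<exists>u\<in>lists (letters G \<Sigma>). length u \<le> K \<and> h = g \<otimes> word_val G u)"

lemma near_refl: "g \<in> carrier G \<Longrightarrow> near K g g"
  unfolding near_def by (intro bexI[of _ "[]"]) (simp_all add: word_val_Nil)

lemma near_sym:
  assumes "g \<in> carrier G" "near K g h"
  shows "near K h g"
proof -
  obtain u where u: "u \<in> lists (letters G \<Sigma>)" "length u \<le> K" "h = g \<otimes> word_val G u"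
    using assms by (auto simp: near_def)
  obtain v where v: "v \<in> lists (letters G \<Sigma>)" "length v = length u"
    "word_val G v = inv (word_val G u)"
    using ex_inverse_word u(1) by blast
  have "h \<otimes> word_val G v = g"
    using assms u v by (simp add: m_assoc)
  then show ?thesis
    unfolding near_def using u v by (intro bexI[of _ v]) auto
qed

lemma near_cayley_dist: "g \<in> carrier G \<Longrightarrow> near K g h \<Longrightarrow> cayley_dist G \<Sigma> g h \<le> K"
  unfolding near_def using cayley_dist_le order_trans by blast

lemma path_vertex_closed [simp]:
  "w \<in> lists (letters G \<Sigma>) \<Longrightarrow> path_vertex G w i \<in> carrier G"
  by (simp only: path_vertex_def word_val_closed take_in_lists)

section \<open>Criteria for asynchronous fellow travelling\<close>

lemma async_fellow_travelI:
  assumes "w \<in> lists (letters G \<Sigma>)" "v \<in> lists (letters G \<Sigma>)"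
    and "f \<in> {0..length w} \<rightarrow> {0..length v}" "mono_on {0..length w} f"
    and "g \<in> {0..length v} \<rightarrow> {0..length w}" "mono_on {0..length v} g"
    and "\<And>i. i \<le> length w \<Longrightarrow> near K (path_vertex G w i) (path_vertex G v (f i))"
    and "\<And>j. j \<le> length v \<Longrightarrow> near K (path_vertex G v j) (path_vertex G w (g j))"
  shows "async_fellow_travel G \<Sigma> K w v"
  unfolding async_fellow_travel_def
  by (rule exI[of _ f], rule exI[of _ g])
     (use assms(3-6) in \<open>safe intro!: near_cayley_dist path_vertex_closed[OF assms(1)]
        path_vertex_closed[OF assms(2)] assms(7,8), simp_all\<close>)

lemma async_fellow_travel_mono:
  "async_fellow_travel G \<Sigma> K w v \<Longrightarrow> K \<le> L \<Longrightarrow> async_fellow_travel G \<Sigma> L w v"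
  unfolding async_fellow_travel_def by (meson order_trans)

lemma async_fellow_travel_synchronous:
  assumes w: "w \<in> lists (letters G \<Sigma>)" and v: "v \<in> lists (letters G \<Sigma>)"
    and len: "length w = length v"
    and near: "\<And>i. i \<le> length w \<Longrightarrow> near K (path_vertex G w i) (path_vertex G v i)"
  shows "async_fellow_travel G \<Sigma> K w v" "async_fellow_travel G \<Sigma> K v w"
proof -
  have near': "near K (path_vertex G v i) (path_vertex G w i)" if "i \<le> length v" for i
    using near[of i] near_sym path_vertex_closed[OF w] len that by simp
  have "mono_on {0..length v} (\<lambda>i. i)" by (simp add: mono_on_def)
  then show "async_fellow_travel G \<Sigma> K w v" "async_fellow_travel G \<Sigma> K v w"
    using async_fellow_travelI[OF w v _ _ _ _ near near']
      async_fellow_travelI[OF v w _ _ _ _ near' near] len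
    by simp_all
qed

text \<open>The subword \<open>u\<close> spells a loop whose vertices are within
  \<open>length u\<close> of its base point. Before and after the loop the two paths visit the same
  vertices.\<close>

lemma async_fellow_travel_delete:
  assumes p: "p \<in> lists (letters G \<Sigma>)" and u: "u \<in> lists (letters G \<Sigma>)"
    and r: "r \<in> lists (letters G \<Sigma>)" and one: "word_val G u = \<one>"
  shows "async_fellow_travel G \<Sigma> (length u) (p @ u @ r) (p @ r)"
proof -
  \<comment> \<open>\<open>f\<close> collapses the loop to its base point, the end of
    \<open>p\<close>: on the loop \<open>i - length u\<close> is at most \<open>length p\<close>, so
    the maximum is \<open>length p\<close>. \<open>g\<close> jumps over the loop.\<close>
  define f where "f i = (if i \<le> length p then i else max (length p) (i - length u))" for i
  define g where "g j = (if j \<le> length p then j else j + length u)" for j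
  have near_f: "near (length u) (path_vertex G (p @ r) (f i)) (path_vertex G (p @ u @ r) i)" for i
  proof -
    consider "i \<le> length p" | "length p < i" "i \<le> length p + length u"
      | "length p + length u < i" by linarith
    then show ?thesis
    proof cases
      case 1
      then have "path_vertex G (p @ r) (f i) = path_vertex G (p @ u @ r) i"
        by (simp add: path_vertex_def f_def)
      then show ?thesis using p u r by (metis append_in_lists_conv near_refl path_vertex_closed)
    next
      case 2
      define k where "k = i - length p"
      have "path_vertex G (p @ r) (f i) = word_val G p"
        using 2 by (simp add: path_vertex_def f_def max_def)
      moreover have "path_vertex G (p @ u @ r) i = word_val G p \<otimes> word_val G (take k u)"
        using 2 p u by (simp add: path_vertex_def k_def word_val_append take_in_lists del: in_lists_conv_set)
      ultimately show ?thesis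
        unfolding near_def using u by (intro bexI[of _ "take k u"]) (auto dest: in_set_takeD)
    next
      case 3
      then obtain k where k: "i = length p + (length u + k)"
        by (metis add.assoc le_iff_add less_imp_le)
      then have "f i = length p + k" using 3 by (simp add: f_def)
      then have "path_vertex G (p @ r) (f i) = path_vertex G (p @ u @ r) i"
        using p u r one
        by (simp add: path_vertex_def k word_val_append take_in_lists del: in_lists_conv_set)
      then show ?thesis using p u r by (metis append_in_lists_conv near_refl path_vertex_closed)
    qed
  qed
  \<comment> \<open>\<open>g\<close> is a section of \<open>f\<close>, so the estimate at
    \<open>j\<close> is the one already shown at \<open>g j\<close>.\<close>
  have "f (g j) = j" for j by (simp add: f_def g_def)
  then have near_g: "near (length u) (path_vertex G (p @ r) j) (path_vertex G (p @ u @ r) (g j))" for j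
    using near_f[of "g j"] by simp
  have f_near: "near (length u) (path_vertex G (p @ u @ r) i) (path_vertex G (p @ r) (f i))" for i
    using p r by (intro near_sym[OF path_vertex_closed near_f]) simp
  have "f \<in> {0..length (p @ u @ r)} \<rightarrow> {0..length (p @ r)}" "mono_on {0..length (p @ u @ r)} f"
    "g \<in> {0..length (p @ r)} \<rightarrow> {0..length (p @ u @ r)}" "mono_on {0..length (p @ r)} g"
    by (auto simp: f_def g_def mono_on_def)
  moreover have "p @ u @ r \<in> lists (letters G \<Sigma>)" "p @ r \<in> lists (letters G \<Sigma>)"
    using p u r by (simp_all del: in_lists_conv_set)
  ultimately show ?thesis
    by (intro async_fellow_travelI[of _ _ f g] near_g f_near)
qed

text \<open>The paths have equal length and are compared at equal times. While \<open>q\<close> is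
  being read, one path lags by one letter of \<open>q\<close> because it has read \<open>s\<close>
  first: \<open>conj\<close> costs \<open>K\<close> and the lag costs one more. Once both have read
  \<open>s\<close> and \<open>q\<close>, \<open>comm\<close> makes them coincide.\<close>

lemma async_fellow_travel_move:
  assumes p: "p \<in> lists (letters G \<Sigma>)" and q: "q \<in> lists (letters G \<Sigma>)"
    and r: "r \<in> lists (letters G \<Sigma>)" and s: "s \<in> letters G \<Sigma>"
    and comm: "s \<otimes> word_val G q = word_val G q \<otimes> s"
    and conj: "\<And>k. k < length q \<Longrightarrow> near K (word_val G (take k q)) (s \<otimes> word_val G (take k q))"
  shows "async_fellow_travel G \<Sigma> (Suc K) (p @ s # q @ r) (p @ q @ s # r)"
    and "async_fellow_travel G \<Sigma> (Suc K) (p @ q @ s # r) (p @ s # q @ r)"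
proof -
  have s': "s \<in> carrier G" using s letters_carrier by auto
  note wv = word_val_append word_val_Cons word_val_Nil take_in_lists
  have "near (Suc K) (path_vertex G (p @ s # q @ r) i) (path_vertex G (p @ q @ s # r) i)" for i
  proof -
    consider "i \<le> length p" | k where "i = length p + Suc k" "k < length q"
      | k where "i = length p + length q + Suc k"
      by atomize_elim presburger
    then show ?thesis
    proof cases
      case 1
      then show ?thesis using p by (simp add: path_vertex_def near_refl take_in_lists del: in_lists_conv_set)
    next
      case 2
      define x where "x = word_val G (take k q)"
      have tk: "take k q \<in> lists (letters G \<Sigma>)" "[q ! k] \<in> lists (letters G \<Sigma>)"
        using q 2 by (auto dest: in_set_takeD)
      then have x: "x \<in> carrier G" "q ! k \<in> carrier G" using letters_carrier by (auto simp: x_def)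
      have "near K (s \<otimes> x) x" using near_sym[OF _ conj[OF 2(2)]] x by (simp add: x_def)
      then obtain z where z: "z \<in> lists (letters G \<Sigma>)" "length z \<le> K" "x = s \<otimes> x \<otimes> word_val G z"
        by (auto simp: near_def)
      have 1: "path_vertex G (p @ s # q @ r) i = word_val G p \<otimes> (s \<otimes> x)"
        using 2 p q s tk by (simp add: path_vertex_def wv x_def del: in_lists_conv_set)
      \<comment> \<open>The second path has already read \<open>q ! k\<close>, so \<open>z\<close>
        followed by this letter leads from the first vertex to the second.\<close>
      have "path_vertex G (p @ q @ s # r) i = word_val G p \<otimes> (x \<otimes> q ! k)"
        using 2 p q s tk x
        by (simp add: path_vertex_def wv x_def take_Suc_conv_app_nth del: in_lists_conv_set)
      also have "x \<otimes> q ! k = s \<otimes> x \<otimes> word_val G z \<otimes> q ! k" using z by simp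
      also have "word_val G p \<otimes> \<dots> = path_vertex G (p @ s # q @ r) i \<otimes> word_val G (z @ [q ! k])"
        unfolding 1 using x s' p z(1) tk by (simp add: wv m_assoc del: in_lists_conv_set)
      finally show ?thesis
        unfolding near_def using z tk by (intro bexI[of _ "z @ [q ! k]"]) auto
    next
      case 3
      have "path_vertex G (p @ s # q @ r) i = path_vertex G (p @ q @ s # r) i"
        using 3 p q r s s' comm
        by (simp add: path_vertex_def wv del: in_lists_conv_set) (simp add: m_assoc[symmetric] take_in_lists del: in_lists_conv_set)
      then show ?thesis using p q r s near_refl path_vertex_closed[of "p @ q @ s # r" i] by simp
    qed
  qed
  then show "async_fellow_travel G \<Sigma> (Suc K) (p @ s # q @ r) (p @ q @ s # r)"
    and "async_fellow_travel G \<Sigma> (Suc K) (p @ q @ s # r) (p @ s # q @ r)"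
    using p q r s
      async_fellow_travel_synchronous[of "p @ s # q @ r" "p @ q @ s # r" "Suc K"]
    by auto
qed

section \<open>From a reduction procedure to SL-FFTP\<close>

text \<open>Repeated reduction keeps the value and, by well-foundedness, ends in \<open>N\<close>,
  by \<open>unique\<close> at the only word of \<open>N\<close> with that value. So the words of
  \<open>N\<close> are shortlex least and lie in \<open>SL_set\<close>; a word outside
  \<open>SL_set\<close> is then outside \<open>N\<close>, and \<open>reduce\<close> applies to
  it.\<close>

lemma SL_FFTP_if_normal_forms:
  assumes wf: "wf r" and tr: "trans r"
    and reduce: "\<And>w. w \<in> lists (letters G \<Sigma>) \<Longrightarrow> w \<notin> N \<Longrightarrow>
      \<exists>v\<in>lists (letters G \<Sigma>). async_fellow_travel G \<Sigma> K w v \<and>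
         word_val G w = word_val G v \<and> (v, w) \<in> lenlex r"
    and unique: "\<And>w v. w \<in> N \<Longrightarrow> v \<in> N \<Longrightarrow> w \<in> lists (letters G \<Sigma>) \<Longrightarrow> v \<in> lists (letters G \<Sigma>)
      \<Longrightarrow> word_val G w = word_val G v \<Longrightarrow> w = v"
  shows "SL_FFTP G \<Sigma> r"
proof -
  have wfl: "wf (lenlex r)" using wf by (rule wf_lenlex)
  have "w \<in> SL_set G \<Sigma> r" if w: "w \<in> lists (letters G \<Sigma>)" "w \<in> N" for w
  proof -
    have least: "v = w \<or> (w, v) \<in> lenlex r"
      if "v \<in> lists (letters G \<Sigma>)" "word_val G v = word_val G w" for v
      using wfl that
    proof (induction v rule: wf_induct_rule)
      case (less v)
      show ?case
      proof (cases "v \<in> N")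
        case True
        then show ?thesis using unique w less by auto
      next
        case False
        then obtain v' where v': "v' \<in> lists (letters G \<Sigma>)" "word_val G v = word_val G v'"
          "(v', v) \<in> lenlex r"
          using reduce less by blast
        then have "v' = w \<or> (w, v') \<in> lenlex r" using less by simp
        then show ?thesis using v' lenlex_trans[OF _ _ tr] by blast
      qed
    qed
    have "SL G \<Sigma> r (word_val G w) = w"
      unfolding SL_def
    proof (rule the_equality)
      fix v assume "v \<in> lists (letters G \<Sigma>) \<and> word_val G v = word_val G w \<and>
        (\<forall>u\<in>lists (letters G \<Sigma>). word_val G u = word_val G w \<longrightarrow> u = v \<or> (v, u) \<in> lenlex r)"
      \<comment> \<open>Two distinct least words would each precede the other.\<close>
      then show "v = w" using least w wf_asym[OF wfl] by metis
    qed (use w least in auto)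
    then show ?thesis
      unfolding SL_set_def using w word_val_closed by (metis imageI)
  qed
  then show ?thesis unfolding SL_FFTP_def using reduce by meson
qed

end

end

section \<open>Strict orders given by finite lists\<close>

lemma trans_list_order:
  assumes "distinct xs"
  shows "trans (list_order xs)"
proof (rule transI)
  fix x y z assume "(x, y) \<in> list_order xs" "(y, z) \<in> list_order xs"
  then obtain i j k l where "x = xs ! i" "y = xs ! j" "i < j" "j < length xs"
    "y = xs ! k" "z = xs ! l" "k < l" "l < length xs"
    unfolding list_order_def by blast
  moreover from this assms have "j = k" by (simp add: nth_eq_iff_index_eq)
  ultimately show "(x, z) \<in> list_order xs" unfolding list_order_def by force
qed

lemma wf_list_order:
  assumes "distinct xs"
  shows "wf (list_order xs)"
proof (rule finite_acyclic_wf)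
  have "list_order xs \<subseteq> set xs \<times> set xs" by (auto simp: list_order_def)
  then show "finite (list_order xs)" using finite_subset by blast
  have "irrefl (list_order xs)"
    using assms by (auto simp: irrefl_def list_order_def nth_eq_iff_index_eq)
  then show "acyclic (list_order xs)"
    using trans_list_order[OF assms] by (simp add: acyclic_irrefl)
qed


lemma nth_list_order: "i < j \<Longrightarrow> j < length xs \<Longrightarrow> (xs ! i, xs ! j) \<in> list_order xs"
  unfolding list_order_def by blast


section \<open>Signed words in the letters \<open>a\<close>, \<open>a\<^sup>-\<^sup>1\<close>, \<open>t\<close>\<close>

text \<open>The formal inverse of \<open>T\<close> is left out because t is its own inverse in G;
  \<open>letter\<close> maps these three signed letters onto the alphabet.\<close>

definition basic :: "(gen \<times> bool) set" where
  "basic = {(A, True), (A, False), (T, True)}"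

definition apow :: "int \<Rightarrow> gen signed_word" where
  "apow k = replicate (nat \<bar>k\<bar>) (A, 0 \<le> k)"

text \<open>The listed factors represent 1 in G, so deleting one shortens the word without changing
  its value.\<close>

definition cancels :: "gen signed_word \<Rightarrow> bool" where
  "cancels w \<longleftrightarrow> (\<exists>p r. (\<exists>e. w = p @ [(A, e), (A, \<not> e)] @ r) \<or> w = p @ [(T, True), (T, True)] @ r)"

lemma cancels_append:
  assumes "cancels w"
  shows "cancels (u @ w @ v)"
proof -
  obtain p r c where w: "w = p @ c @ r"
    and c: "(\<exists>e. c = [(A, e), (A, \<not> e)]) \<or> c = [(T, True), (T, True)]"
    using assms unfolding cancels_def by blast
  have "u @ w @ v = (u @ p) @ c @ (r @ v)" by (simp add: w)
  then show ?thesis using c unfolding cancels_def by blast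
qed

lemma cancels_Cons: "cancels w \<Longrightarrow> cancels (l # w)"
  using cancels_append[of w "[l]" "[]"] by simp

lemma cancels_TT: "cancels (p @ (T, True) # (T, True) # r)"
  unfolding cancels_def by auto

lemma apow_0 [simp]: "apow 0 = []"
  by (simp add: apow_def)

lemma apow_split:
  assumes "k \<noteq> 0" "e \<longleftrightarrow> 0 \<le> k"
  obtains j where "apow k = (A, e) # apow j" "apow k = apow j @ [(A, e)]"
proof -
  \<comment> \<open>One step towards 0. For \<open>k = -1\<close> this gives \<open>j = 0\<close>,
    whose sign test differs from that of \<open>k\<close>, but then no letter is left.\<close>
  define j where "j = (if 0 \<le> k then k - 1 else k + 1)"
  have "apow j = replicate (nat \<bar>j\<bar>) (A, e)"
    using assms by (cases "0 \<le> k"; cases "j = 0") (simp_all add: apow_def j_def)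
  moreover have "nat \<bar>k\<bar> = Suc (nat \<bar>j\<bar>)" using assms by (auto simp: j_def)
  ultimately show ?thesis
    using that[of j] assms(2) by (simp add: apow_def[of k] replicate_append_same)
qed

lemma apow_Cons_same_sign:
  assumes "k = 0 \<or> (e \<longleftrightarrow> 0 \<le> k)"
  shows "\<exists>j. (A, e) # apow k = apow j"
proof
  define j where "j = (if e then k + 1 else k - 1)"
  have "nat \<bar>j\<bar> = Suc (nat \<bar>k\<bar>)" "0 \<le> j \<longleftrightarrow> e" using assms by (auto simp: j_def)
  then show "(A, e) # apow k = apow j" using assms by (auto simp: apow_def)
qed

text \<open>A letter put before a block of its own sign lengthens it; before a block of opposite
  sign it meets its inverse.\<close>

lemma apow_Cons:
  obtains j where "(A, e) # apow k = apow j" | "cancels ((A, e) # apow k)"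
proof (cases "k = 0 \<or> (e \<longleftrightarrow> 0 \<le> k)")
  case True
  then show ?thesis using apow_Cons_same_sign that(1) by blast
next
  case False
  then obtain j where "apow k = (A, \<not> e) # apow j" using apow_split[of k "\<not> e"] by blast
  then have "(A, e) # apow k = [] @ [(A, e), (A, \<not> e)] @ apow j" by simp
  then show ?thesis using that(2) unfolding cancels_def by blast
qed

lemma apow_snoc:
  obtains j where "apow k @ [(A, e)] = apow j" | "cancels (apow k @ [(A, e)])"
proof (cases "k = 0 \<or> (e \<longleftrightarrow> 0 \<le> k)")
  case True
  then have "apow k @ [(A, e)] = (A, e) # apow k"
    by (auto simp: apow_def replicate_append_same)
  then show ?thesis using True apow_Cons_same_sign that(1) by metis
next
  case False
  then obtain j where "apow k = apow j @ [(A, \<not> e)]" using apow_split[of k "\<not> e"] by blast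
  then have "apow k @ [(A, e)] = apow j @ [(A, \<not> e), (A, \<not> \<not> e)] @ []" by simp
  then show ?thesis using that(2) unfolding cancels_def by blast
qed

section \<open>Normal forms and the words to which no move applies\<close>

text \<open>The index stands for a^m (t a t)^n, times t if \<open>b\<close>. With \<open>b\<close>
  the last two t cancel; without it, a^m and t a^n t commute and the factor starting with the least
  letter t comes first. The case \<open>n = 0\<close> is separate since it would leave a factor
  tt.\<close>

fun nf_t_least :: "int \<times> int \<times> bool \<Rightarrow> gen signed_word" where
  "nf_t_least (m, n, b) =
     (if b then apow m @ (T, True) # apow n
      else if n = 0 then apow m
      else (T, True) # apow n @ (T, True) # apow m)"

text \<open>With t greatest, the commuting factors a^m and t a^n t appear in the opposite
  order.\<close>

fun nf_t_greatest :: "int \<times> int \<times> bool \<Rightarrow> gen signed_word" where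
  "nf_t_greatest (m, n, b) =
     (if b then apow m @ (T, True) # apow n
      else if n = 0 then apow m
      else apow m @ (T, True) # apow n @ [(T, True)])"

text \<open>Induction from the right end of the word: a letter put before a normal form gives a
  normal form, a cancelling pair or a letter standing before some t a^k t.\<close>

lemma nf_t_least_cases:
  assumes "w \<in> lists basic"
  shows "w \<in> range nf_t_least \<or> cancels w \<or>
    (\<exists>p e k r. w = p @ (A, e) # ((T, True) # apow k @ [(T, True)]) @ r)"
  using assms
proof (induction w rule: list.induct)
  case Nil
  have "[] = nf_t_least (0, 0, False)" by simp
  then show ?case by (metis rangeI)
next
  case (Cons l w)
  have "l \<in> basic" using Cons.prems by auto
  then have l: "l = (T, True) \<or> (\<exists>e. l = (A, e))" unfolding basic_def by blast
  consider (nf) m n b where "w = nf_t_least (m, n, b)" | (cancels) "cancels w"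
    | (move) p e k r where "w = p @ (A, e) # ((T, True) # apow k @ [(T, True)]) @ r"
    using Cons by fastforce
  then show ?case
  proof cases
    case nf
    \<comment> \<open>In T0 and T3 two t meet; in T1 and T2 the new t swaps the coordinates and
      flips \<open>b\<close>. In A1 and A2 the letter extends the block a^m or cancels with it. Only
      A3 produces a move.\<close>
    consider (T0) "l = (T, True)" "b" "m = 0" | (T1) "l = (T, True)" "b" "m \<noteq> 0"
      | (T2) "l = (T, True)" "\<not> b" "n = 0" | (T3) "l = (T, True)" "\<not> b" "n \<noteq> 0"
      | (A1) e where "l = (A, e)" "b" | (A2) e where "l = (A, e)" "\<not> b" "n = 0"
      | (A3) e where "l = (A, e)" "\<not> b" "n \<noteq> 0"
      using l by blast
    then show ?thesis
    proof cases
      case T0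
      then show ?thesis using nf cancels_TT[of "[]"] by simp
    next
      case T1
      then have "l # w = nf_t_least (n, m, False)" using nf by simp
      then show ?thesis by (metis rangeI)
    next
      case T2
      then have "l # w = nf_t_least (0, m, True)" using nf by simp
      then show ?thesis by (metis rangeI)
    next
      case T3
      then show ?thesis using nf cancels_TT[of "[]"] by simp
    next
      case A1
      show ?thesis
      proof (rule apow_Cons[of e m])
        fix j assume "(A, e) # apow m = apow j"
        then have "l # w = nf_t_least (j, n, True)" using nf A1 by simp
        then show ?thesis by (metis rangeI)
      next
        assume "cancels ((A, e) # apow m)"
        then show ?thesis using nf A1 cancels_append[of "(A, e) # apow m" "[]"] by simp
      qed
    next
      case A2
      show ?thesis
      proof (rule apow_Cons[of e m])
        fix j assume "(A, e) # apow m = apow j"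
        then have "l # w = nf_t_least (j, 0, False)" using nf A2 by simp
        then show ?thesis by (metis rangeI)
      qed (use nf A2 in simp)
    next
      case A3
      then have "l # w = [] @ (A, e) # ((T, True) # apow n @ [(T, True)]) @ apow m"
        using nf by simp
      then show ?thesis by blast
    qed
  next
    case cancels
    then show ?thesis using cancels_Cons by blast
  next
    case move
    then have "l # w = (l # p) @ (A, e) # ((T, True) # apow k @ [(T, True)]) @ r" by simp
    then show ?thesis by blast
  qed
qed

text \<open>Mirror image of \<open>nf_t_least_cases\<close>: letters are appended, and the only move
  arises when a letter a or its inverse follows t a^n t with \<open>n\<close> nonzero.\<close>

lemma nf_t_greatest_cases:
  assumes "w \<in> lists basic"
  shows "w \<in> range nf_t_greatest \<or> cancels w \<or>
    (\<exists>p e k r. w = p @ ((T, True) # apow k @ [(T, True)]) @ (A, e) # r)"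
  using assms
proof (induction w rule: rev_induct)
  case Nil
  have "[] = nf_t_greatest (0, 0, False)" by simp
  then show ?case by (metis rangeI)
next
  case (snoc l w)
  have "l \<in> basic" using snoc.prems by simp
  then have l: "l = (T, True) \<or> (\<exists>e. l = (A, e))" unfolding basic_def by blast
  consider (nf) m n b where "w = nf_t_greatest (m, n, b)" | (cancels) "cancels w"
    | (move) p e k r where "w = p @ ((T, True) # apow k @ [(T, True)]) @ (A, e) # r"
    using snoc by fastforce
  then show ?case
  proof cases
    case nf
    consider (T0) "l = (T, True)" "b" "n = 0" | (T1) "l = (T, True)" "b" "n \<noteq> 0"
      | (T2) "l = (T, True)" "\<not> b" "n = 0" | (T3) "l = (T, True)" "\<not> b" "n \<noteq> 0"
      | (A1) e where "l = (A, e)" "b" | (A2) e where "l = (A, e)" "\<not> b" "n = 0"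
      | (A3) e where "l = (A, e)" "\<not> b" "n \<noteq> 0"
      using l by blast
    then show ?thesis
    proof cases
      case T0
      then show ?thesis using nf cancels_TT[of "apow m" "[]"] by simp
    next
      case T1
      then have "w @ [l] = nf_t_greatest (m, n, False)" using nf by simp
      then show ?thesis by (metis rangeI)
    next
      case T2
      then have "w @ [l] = nf_t_greatest (m, 0, True)" using nf by simp
      then show ?thesis by (metis rangeI)
    next
      case T3
      then show ?thesis using nf cancels_TT[of "apow m @ (T, True) # apow n" "[]"] by simp
    next
      case A1
      show ?thesis
      proof (rule apow_snoc[of n e])
        fix j assume "apow n @ [(A, e)] = apow j"
        then have "w @ [l] = nf_t_greatest (m, j, True)" using nf A1 by simp
        then show ?thesis by (metis rangeI)
      next
        assume "cancels (apow n @ [(A, e)])"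
        then show ?thesis
          using nf A1 cancels_append[of "apow n @ [(A, e)]" "apow m @ [(T, True)]" "[]"] by simp
      qed
    next
      case A2
      show ?thesis
      proof (rule apow_snoc[of m e])
        fix j assume "apow m @ [(A, e)] = apow j"
        then have "w @ [l] = nf_t_greatest (j, 0, False)" using nf A2 by simp
        then show ?thesis by (metis rangeI)
      qed (use nf A2 in simp)
    next
      case A3
      then have "w @ [l] = apow m @ ((T, True) # apow n @ [(T, True)]) @ (A, e) # []"
        using nf by simp
      then show ?thesis by blast
    qed
  next
    case cancels
    then show ?thesis using cancels_append[of w "[]"] by simp
  next
    case move
    then have "w @ [l] = p @ ((T, True) # apow k @ [(T, True)]) @ (A, e) # (r @ [l])" by simp
    then show ?thesis by blast
  qed
qed


section \<open>The action of \<open>G\<close> on \<open>\<int>\<^sup>2 \<rtimes> \<int>/2\<close>\<close>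

text \<open>The triple \<open>(m, n, b)\<close> stands for \<open>a\<^sup>m (t a t)\<^sup>n\<close>, followed by \<open>t\<close> if \<open>b\<close> holds.\<close>

fun step :: "gen \<times> bool \<Rightarrow> int \<times> int \<times> bool \<Rightarrow> int \<times> int \<times> bool" where
  "step (A, e) (m, n, b) = (m + (if e then 1 else - 1), n, b)"
| "step (T, e) (m, n, b) = (n, m, \<not> b)"

text \<open>Both relations hold for the action, so a group element determines how its words act.
  This is the invariant separating the normal forms.\<close>

lemma pres_eq_foldr_step:
  assumes "pres_eq G_rels u v"
  shows "foldr step u = foldr step v"
  using assms
proof (induction rule: pres_eq.induct)
  case (rel u v)
  then show ?case by (auto simp: G_rels_def fun_eq_iff)
next
  case (cancel x e)
  then show ?case by (cases x) (auto simp: fun_eq_iff)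
next
  case (app u u' v v')
  then show ?case by (intro ext) simp
qed auto

lemma foldr_step_apow [simp]: "foldr step (apow k) (m, n, b) = (m + k, n, b)"
proof -
  have "foldr step (replicate j (A, e)) (m, n, b) = (m + (if e then int j else - int j), n, b)"
    for j e by (induction j) auto
  then show ?thesis by (simp add: apow_def)
qed

text \<open>The orbit of one base point recovers the index of a normal form.\<close>

lemma foldr_step_nf:
  "foldr step (nf_t_least x) (0, 0, False) = x"
  "foldr step (nf_t_greatest x) (0, 0, False) = x"
  by (cases x; simp)+


section \<open>Reduction of words in \<open>G\<close>\<close>

interpretation G_at: group G_at
  by (rule G_at_group)

definition letter :: "gen \<times> bool \<Rightarrow> gen signed_word set" where
  "letter l = pres_class G_rels [l]"

abbreviation gens :: "gen signed_word set set" where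
  "gens \<equiv> {a_G, t_G}"

lemma gens_carrier: "gens \<subseteq> carrier G_at"
  by (simp add: a_G_carrier t_G_carrier)

lemma letter_simps: "letter (A, True) = a_G" "letter (A, False) = inv\<^bsub>G_at\<^esub> a_G" "letter (T, True) = t_G"
  by (simp_all add: letter_def a_G_def[symmetric] t_G_def[symmetric] inv_a_G)

lemma letters_eq: "letters G_at gens = letter ` basic"
  by (auto simp: letters_G_at basic_def letter_simps)

lemma letter_in_letters: "letter (A, e) \<in> letters G_at gens" "t_G \<in> letters G_at gens"
  by (cases e; simp add: letters_G_at letter_simps)+

lemma word_val_map_letter: "word_val G_at (map letter u) = pres_class G_rels u"
proof (induction u)
  case Nil
  show ?case by (simp add: word_val_def G_at_def presented_group_one)
next
  case (Cons l u)
  then show ?case by (simp add: word_val_def letter_def G_at_def presented_group_mult)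
qed

lemma letter_carrier [simp]: "letter l \<in> carrier G_at"
  by (simp add: letter_def G_at_def presented_group_carrier)

section \<open>Conjugates of a and moving letters across t a^k t\<close>

lemma t_t: "t_G \<otimes>\<^bsub>G_at\<^esub> t_G = \<one>\<^bsub>G_at\<^esub>"
  using G_at.r_inv[OF t_G_carrier] by (simp add: inv_t_G)

definition conj_t :: "bool \<Rightarrow> gen signed_word set" where
  "conj_t e = t_G \<otimes>\<^bsub>G_at\<^esub> letter (A, e) \<otimes>\<^bsub>G_at\<^esub> t_G"

lemma conj_t_carrier [simp]: "conj_t e \<in> carrier G_at"
  by (simp add: conj_t_def t_G_carrier)

lemma (in group) commute_inv:
  assumes "x \<in> carrier G" "y \<in> carrier G" "x \<otimes> y = y \<otimes> x"
  shows "inv x \<otimes> y = y \<otimes> inv x"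
proof -
  have "inv x \<otimes> y = inv x \<otimes> (y \<otimes> x) \<otimes> inv x"
    using assms(1,2) by (simp add: m_assoc)
  also have "\<dots> = inv x \<otimes> (x \<otimes> y) \<otimes> inv x" using assms(3) by simp
  also have "\<dots> = y \<otimes> inv x" using assms(1,2) by (simp add: m_assoc[symmetric])
  finally show ?thesis .
qed

text \<open>The relation atat = tata says that a commutes with tat; \<open>commute_inv\<close>
  extends this to the inverses on either side.\<close>

lemma conj_t_commute:
  "conj_t e \<otimes>\<^bsub>G_at\<^esub> letter (A, e') = letter (A, e') \<otimes>\<^bsub>G_at\<^esub> conj_t e"
proof -
  have "pres_eq G_rels [(A, True), (T, True), (A, True), (T, True)]
    [(T, True), (A, True), (T, True), (A, True)]"
    by (rule pres_eq.rel) (simp add: G_rels_def)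
  then have "pres_class G_rels [(A, True), (T, True), (A, True), (T, True)] =
    pres_class G_rels [(T, True), (A, True), (T, True), (A, True)]"
    by (simp only: pres_class_eq_iff)
  then have 1: "conj_t True \<otimes>\<^bsub>G_at\<^esub> a_G = a_G \<otimes>\<^bsub>G_at\<^esub> conj_t True"
    by (simp add: conj_t_def letter_def a_G_def t_G_def G_at_def presented_group_mult)
  have conj_False: "conj_t False = inv\<^bsub>G_at\<^esub> conj_t True"
    by (simp add: conj_t_def letter_simps G_at.inv_mult_group a_G_carrier t_G_carrier inv_t_G
        G_at.m_assoc)
  have "conj_t True \<otimes>\<^bsub>G_at\<^esub> letter (A, e') = letter (A, e') \<otimes>\<^bsub>G_at\<^esub> conj_t True"
    using 1 G_at.commute_inv[OF _ _ 1[symmetric]]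
    by (cases e') (simp_all add: letter_simps a_G_carrier)
  then show ?thesis
    using G_at.commute_inv[of "conj_t True" "letter (A, e')"]
    by (cases e) (simp_all add: conj_False)
qed

lemma letter_A_commute:
  "letter (A, e) \<otimes>\<^bsub>G_at\<^esub> letter (A, e') = letter (A, e') \<otimes>\<^bsub>G_at\<^esub> letter (A, e)"
  by (cases e; cases e') (simp_all add: letter_simps a_G_carrier)

lemma letter_A_t: "letter (A, e) \<otimes>\<^bsub>G_at\<^esub> t_G = t_G \<otimes>\<^bsub>G_at\<^esub> conj_t e"
  by (simp add: conj_t_def t_G_carrier G_at.m_assoc[symmetric] t_t)

lemma conj_t_t: "conj_t e \<otimes>\<^bsub>G_at\<^esub> t_G = t_G \<otimes>\<^bsub>G_at\<^esub> letter (A, e)"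
  by (simp add: conj_t_def t_G_carrier G_at.m_assoc t_t)

lemmas wv_Nil = G_at.word_val_Nil[OF gens_carrier]
lemmas wv_Cons = G_at.word_val_Cons[OF gens_carrier]
lemmas wv_append = G_at.word_val_append[OF gens_carrier]
lemmas wv_closed = G_at.word_val_closed[OF gens_carrier]

text \<open>The conjugate of a letter s under \<open>q\<close> stays in {s, tst}: each further t
  swaps the two elements, and each a or inverse of a fixes both.\<close>

lemma letter_A_conj:
  assumes "q \<in> lists (letters G_at gens)"
  shows "\<exists>z\<in>{letter (A, e), conj_t e}.
    letter (A, e) \<otimes>\<^bsub>G_at\<^esub> word_val G_at q = word_val G_at q \<otimes>\<^bsub>G_at\<^esub> z"
  using assms
proof (induction q rule: rev_induct)
  case Nil
  show ?case by (simp add: wv_Nil)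
next
  case (snoc l q)
  then have q: "q \<in> lists (letters G_at gens)" and l: "l \<in> letters G_at gens" by auto
  obtain z where z: "z \<in> {letter (A, e), conj_t e}"
    "letter (A, e) \<otimes>\<^bsub>G_at\<^esub> word_val G_at q = word_val G_at q \<otimes>\<^bsub>G_at\<^esub> z"
    using snoc.IH q by blast
  have "l = t_G \<or> (\<exists>e'. l = letter (A, e'))"
    using l unfolding letters_eq basic_def by (auto simp: letter_simps(3))
  then consider "z = letter (A, e)" "l = t_G" | "z = conj_t e" "l = t_G"
    | e' where "z = letter (A, e)" "l = letter (A, e')"
    | e' where "z = conj_t e" "l = letter (A, e')"
    using z(1) by blast
  then obtain z' where z': "z' \<in> {letter (A, e), conj_t e}" "z \<otimes>\<^bsub>G_at\<^esub> l = l \<otimes>\<^bsub>G_at\<^esub> z'"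
  proof cases
    case 1
    then show ?thesis using that[of "conj_t e"] letter_A_t[of e] by simp
  next
    case 2
    then show ?thesis using that[of "letter (A, e)"] conj_t_t[of e] by simp
  next
    case 3
    then show ?thesis using that[of "letter (A, e)"] letter_A_commute[of e] by simp
  next
    case 4
    then show ?thesis using that[of "conj_t e"] conj_t_commute[of e] by simp
  qed
  have c: "l \<in> carrier G_at" "z \<in> carrier G_at" "z' \<in> carrier G_at" "word_val G_at q \<in> carrier G_at"
    using l q z(1) z'(1) G_at.letters_carrier[OF gens_carrier] wv_closed by auto
  have "word_val G_at (q @ [l]) = word_val G_at q \<otimes>\<^bsub>G_at\<^esub> l"
    using q l c by (simp add: wv_append wv_Cons wv_Nil)
  moreover have "letter (A, e) \<otimes>\<^bsub>G_at\<^esub> (word_val G_at q \<otimes>\<^bsub>G_at\<^esub> l)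
    = word_val G_at q \<otimes>\<^bsub>G_at\<^esub> z \<otimes>\<^bsub>G_at\<^esub> l"
    using c by (simp add: z(2)[symmetric] G_at.m_assoc)
  moreover have "\<dots> = word_val G_at q \<otimes>\<^bsub>G_at\<^esub> l \<otimes>\<^bsub>G_at\<^esub> z'"
    using c z'(2) by (simp add: G_at.m_assoc)
  ultimately show ?case using z'(1) by metis
qed

text \<open>The constant 3 is the length of the word t s t, whatever the length of
  \<open>q\<close>.\<close>

lemma near_letter_A:
  assumes "q \<in> lists (letters G_at gens)"
  shows "G_at.near gens 3 (word_val G_at q) (letter (A, e) \<otimes>\<^bsub>G_at\<^esub> word_val G_at q)"
proof -
  have 1: "letter (A, e) = word_val G_at [letter (A, e)]"
    by (simp add: wv_Cons wv_Nil)
  have 2: "conj_t e = word_val G_at [t_G, letter (A, e), t_G]"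
    by (simp add: wv_Cons wv_Nil conj_t_def t_G_carrier G_at.m_assoc)
  obtain z where "z = letter (A, e) \<or> z = conj_t e"
    and z: "letter (A, e) \<otimes>\<^bsub>G_at\<^esub> word_val G_at q = word_val G_at q \<otimes>\<^bsub>G_at\<^esub> z"
    using letter_A_conj[OF assms, of e] by blast
  then obtain u where "u = [letter (A, e)] \<or> u = [t_G, letter (A, e), t_G]"
    and u: "z = word_val G_at u"
    using 1 2 by blast
  then have "u \<in> lists (letters G_at gens)" "length u \<le> 3"
    using letter_in_letters by auto
  then show ?thesis
    unfolding G_at.near_def[OF gens_carrier] z u by blast
qed

lemma conj_t_apow_commute:
  "conj_t e \<otimes>\<^bsub>G_at\<^esub> word_val G_at (map letter (apow k)) =
     word_val G_at (map letter (apow k)) \<otimes>\<^bsub>G_at\<^esub> conj_t e"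
proof -
  have "conj_t e \<otimes>\<^bsub>G_at\<^esub> word_val G_at (replicate j (letter (A, e'))) =
     word_val G_at (replicate j (letter (A, e'))) \<otimes>\<^bsub>G_at\<^esub> conj_t e" for j e'
  proof (induction j)
    case (Suc j)
    have "word_val G_at (replicate j (letter (A, e'))) \<in> carrier G_at"
      by (rule wv_closed) (auto simp: letter_in_letters)
    then show ?case
      using Suc conj_t_commute[of e e']
      by (simp add: wv_Cons G_at.m_assoc[symmetric]) (simp add: G_at.m_assoc)
  qed (simp add: wv_Nil)
  then show ?thesis by (simp add: apow_def)
qed

text \<open>Crossing the first t turns s into tst, which commutes with a^k; crossing the second t
  turns it back into s.\<close>

lemma letter_A_tat_commute:
  fixes k defines "q \<equiv> map letter ((T, True) # apow k @ [(T, True)])"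
  shows "letter (A, e) \<otimes>\<^bsub>G_at\<^esub> word_val G_at q = word_val G_at q \<otimes>\<^bsub>G_at\<^esub> letter (A, e)"
proof -
  define x where "x = word_val G_at (map letter (apow k))"
  have ap: "map letter (apow k) \<in> lists (letters G_at gens)"
    by (auto simp: apow_def letter_in_letters)
  then have x: "x \<in> carrier G_at" unfolding x_def by (rule wv_closed)
  have "word_val G_at q = t_G \<otimes>\<^bsub>G_at\<^esub> (x \<otimes>\<^bsub>G_at\<^esub> t_G)"
    using ap letter_in_letters(2)
    by (simp add: q_def x_def wv_Cons wv_append wv_Nil letter_simps t_G_carrier del: in_lists_conv_set)
  moreover have "letter (A, e) \<otimes>\<^bsub>G_at\<^esub> (t_G \<otimes>\<^bsub>G_at\<^esub> (x \<otimes>\<^bsub>G_at\<^esub> t_G)) =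
      t_G \<otimes>\<^bsub>G_at\<^esub> (conj_t e \<otimes>\<^bsub>G_at\<^esub> x) \<otimes>\<^bsub>G_at\<^esub> t_G"
    using letter_A_t[of e] x t_G_carrier by (simp add: G_at.m_assoc[symmetric])
  moreover have "\<dots> = t_G \<otimes>\<^bsub>G_at\<^esub> x \<otimes>\<^bsub>G_at\<^esub> (conj_t e \<otimes>\<^bsub>G_at\<^esub> t_G)"
    using conj_t_apow_commute[of e k] x t_G_carrier by (simp add: x_def G_at.m_assoc)
  ultimately show ?thesis
    using x t_G_carrier by (simp add: conj_t_t G_at.m_assoc)
qed

text \<open>The constant 4 is 3 from \<open>near_letter_A\<close> plus 1 for the lag in
  \<open>async_fellow_travel_move\<close>. Both directions are given, for t least and for t
  greatest.\<close>

lemma move_across_tat: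
  fixes p r :: "gen signed_word" and e :: bool and k :: int
  assumes "p \<in> lists basic" "r \<in> lists basic"
  defines "w \<equiv> map letter (p @ (A, e) # ((T, True) # apow k @ [(T, True)]) @ r)"
    and "v \<equiv> map letter (p @ ((T, True) # apow k @ [(T, True)]) @ (A, e) # r)"
  shows "async_fellow_travel G_at gens 4 w v" "async_fellow_travel G_at gens 4 v w"
    and "word_val G_at w = word_val G_at v"
    and "w \<in> lists (letters G_at gens)" "v \<in> lists (letters G_at gens)"
proof -
  define P R Q where "P = map letter p" and "R = map letter r"
    and Q_def: "Q = map letter ((T, True) # apow k @ [(T, True)])"
  have w: "w = P @ letter (A, e) # Q @ R" and v: "v = P @ Q @ letter (A, e) # R"
    by (simp_all add: w_def v_def P_def Q_def R_def)
  have PR: "P \<in> lists (letters G_at gens)" "R \<in> lists (letters G_at gens)"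
    using assms(1,2) by (auto simp: P_def R_def letters_eq)
  have Q: "Q \<in> lists (letters G_at gens)"
    by (auto simp: Q_def apow_def letter_in_letters letter_simps(3))
  have comm: "letter (A, e) \<otimes>\<^bsub>G_at\<^esub> word_val G_at Q = word_val G_at Q \<otimes>\<^bsub>G_at\<^esub> letter (A, e)"
    unfolding Q_def by (rule letter_A_tat_commute)
  have near: "G_at.near gens 3 (word_val G_at (take i Q))
    (letter (A, e) \<otimes>\<^bsub>G_at\<^esub> word_val G_at (take i Q))" for i
    using Q by (intro near_letter_A) (auto dest: in_set_takeD)
  show "async_fellow_travel G_at gens 4 w v" "async_fellow_travel G_at gens 4 v w"
    using G_at.async_fellow_travel_move[OF gens_carrier PR(1) Q PR(2) letter_in_letters(1) comm near]
    by (simp_all add: w v)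
  show "w \<in> lists (letters G_at gens)" "v \<in> lists (letters G_at gens)"
    using PR Q letter_in_letters(1) by (simp_all add: w v)
  have "letter (A, e) \<otimes>\<^bsub>G_at\<^esub> (word_val G_at Q \<otimes>\<^bsub>G_at\<^esub> word_val G_at R) =
    word_val G_at Q \<otimes>\<^bsub>G_at\<^esub> (letter (A, e) \<otimes>\<^bsub>G_at\<^esub> word_val G_at R)"
    using comm PR Q wv_closed by (simp add: G_at.m_assoc[symmetric] del: in_lists_conv_set)
  then show "word_val G_at w = word_val G_at v"
    using PR Q letter_in_letters(1)[of e]
    by (simp add: w v wv_append wv_Cons del: in_lists_conv_set)
qed

lemma delete_cancelling_pair:
  assumes "w \<in> lists basic" "cancels w"
  shows "\<exists>v\<in>lists (letters G_at gens). async_fellow_travel G_at gens 4 (map letter w) v \<and>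
    word_val G_at (map letter w) = word_val G_at v \<and> (v, map letter w) \<in> lenlex r"
proof -
  obtain p c q where w: "w = p @ c @ q"
    and c: "(\<exists>e. c = [(A, e), (A, \<not> e)]) \<or> c = [(T, True), (T, True)]"
    using assms(2) unfolding cancels_def by blast
  define P C Q where "P = map letter p" and "C = map letter c" and "Q = map letter q"
  have W: "map letter w = P @ C @ Q" by (simp add: w P_def C_def Q_def)
  have "map letter w \<in> lists (letters G_at gens)" using assms(1) by (auto simp: letters_eq)
  then have l: "P \<in> lists (letters G_at gens)" "C \<in> lists (letters G_at gens)"
    "Q \<in> lists (letters G_at gens)" by (simp_all add: W)
  have "letter (A, e) \<otimes>\<^bsub>G_at\<^esub> letter (A, \<not> e) = \<one>\<^bsub>G_at\<^esub>" for e
    by (cases e) (simp_all add: letter_simps a_G_carrier)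
  then have one: "word_val G_at C = \<one>\<^bsub>G_at\<^esub>"
    using c t_t by (auto simp: C_def wv_Cons wv_Nil letter_simps(3) t_G_carrier)
  have len: "length C = 2" using c by (auto simp: C_def)
  have "async_fellow_travel G_at gens 2 (P @ C @ Q) (P @ Q)"
    using G_at.async_fellow_travel_delete[OF gens_carrier l one] len by simp
  \<comment> \<open>Weakened from 2 so that deletions and moves share one constant.\<close>
  then have "async_fellow_travel G_at gens 4 (P @ C @ Q) (P @ Q)"
    using G_at.async_fellow_travel_mono[OF gens_carrier] by simp
  moreover have "word_val G_at (P @ C @ Q) = word_val G_at (P @ Q)"
    using l one wv_closed by (simp add: wv_append del: in_lists_conv_set)
  moreover have "(P @ Q, P @ C @ Q) \<in> lenlex r"
    using len by (simp add: lenlex_iff_shortlex)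
  moreover have "P @ Q \<in> lists (letters G_at gens)" using l by simp
  ultimately show ?thesis unfolding W by blast
qed

text \<open>Uniqueness of normal forms comes from \<open>nf\<close>: words with equal values act
  alike on the base point, hence have the same index.\<close>

lemma SL_FFTP_if_nf:
  assumes r: "wf r" "trans r"
    and nf: "\<And>x. foldr step (nf x) (0, 0, False) = x"
    and reduce: "\<And>w. w \<in> lists basic \<Longrightarrow> w \<notin> range nf \<Longrightarrow>
      \<exists>v\<in>lists (letters G_at gens). async_fellow_travel G_at gens 4 (map letter w) v \<and>
        word_val G_at (map letter w) = word_val G_at v \<and> (v, map letter w) \<in> lenlex r"
  shows "SL_FFTP G_at gens r"
proof (rule G_at.SL_FFTP_if_normal_forms[OF gens_carrier r, where N = "map letter ` range nf" and K = 4])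
  fix w assume w: "w \<in> lists (letters G_at gens)" "w \<notin> map letter ` range nf"
  then obtain u where "u \<in> lists basic" "w = map letter u"
    unfolding letters_eq lists_image by blast
  then show "\<exists>v\<in>lists (letters G_at gens). async_fellow_travel G_at gens 4 w v \<and>
      word_val G_at w = word_val G_at v \<and> (v, w) \<in> lenlex r"
    using reduce w by blast
next
  fix w v assume "w \<in> map letter ` range nf" "v \<in> map letter ` range nf"
    and eq: "word_val G_at w = word_val G_at v"
  then obtain x y where w: "w = map letter (nf x)" "v = map letter (nf y)" by blast
  then have "pres_eq G_rels (nf x) (nf y)"
    using eq by (simp add: word_val_map_letter pres_class_eq_iff)
  then have "foldr step (nf x) = foldr step (nf y)" by (rule pres_eq_foldr_step)
  then have "x = y" using nf by metis
  then show "w = v" using w by simp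
qed

lemma SL_FFTP_t_least:
  assumes r: "wf r" "trans r" and t: "\<And>e. (t_G, letter (A, e)) \<in> r"
  shows "SL_FFTP G_at gens r"
proof (rule SL_FFTP_if_nf[OF r foldr_step_nf(1)])
  fix w assume w: "w \<in> lists basic" "w \<notin> range nf_t_least"
  then consider "cancels w"
    | (move) p e k q where "w = p @ (A, e) # ((T, True) # apow k @ [(T, True)]) @ q"
    using nf_t_least_cases by blast
  then show "\<exists>v\<in>lists (letters G_at gens). async_fellow_travel G_at gens 4 (map letter w) v \<and>
    word_val G_at (map letter w) = word_val G_at v \<and> (v, map letter w) \<in> lenlex r"
  proof cases
    case 1
    with w show ?thesis by (intro delete_cancelling_pair)
  next
    case move
    define v where "v = map letter (p @ ((T, True) # apow k @ [(T, True)]) @ (A, e) # q)"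
    have pq: "p \<in> lists basic" "q \<in> lists basic" using w(1) by (simp_all add: move)
    \<comment> \<open>The lengths agree, and at the first difference, just after \<open>p\<close>, a
      letter a or its inverse is replaced by the smaller t.\<close>
    have "(v, map letter w) \<in> lenlex r"
      using t by (simp add: v_def move lenlex_iff_shortlex letter_simps(3) lexord_append_leftI)
    then show ?thesis
      using move_across_tat[OF pq, where e = e and k = k] unfolding v_def move by blast
  qed
qed

lemma SL_FFTP_t_greatest:
  assumes r: "wf r" "trans r" and t: "\<And>e. (letter (A, e), t_G) \<in> r"
  shows "SL_FFTP G_at gens r"
proof (rule SL_FFTP_if_nf[OF r foldr_step_nf(2)])
  fix w assume w: "w \<in> lists basic" "w \<notin> range nf_t_greatest"
  then consider "cancels w"
    | (move) p e k q where "w = p @ ((T, True) # apow k @ [(T, True)]) @ (A, e) # q"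
    using nf_t_greatest_cases by blast
  then show "\<exists>v\<in>lists (letters G_at gens). async_fellow_travel G_at gens 4 (map letter w) v \<and>
    word_val G_at (map letter w) = word_val G_at v \<and> (v, map letter w) \<in> lenlex r"
  proof cases
    case 1
    with w show ?thesis by (intro delete_cancelling_pair)
  next
    case move
    define v where "v = map letter (p @ (A, e) # ((T, True) # apow k @ [(T, True)]) @ q)"
    have pq: "p \<in> lists basic" "q \<in> lists basic" using w(1) by (simp_all add: move)
    \<comment> \<open>Here t is replaced just after \<open>p\<close> by a smaller letter.\<close>
    have "(v, map letter w) \<in> lenlex r"
      using t by (simp add: v_def move lenlex_iff_shortlex letter_simps(3) lexord_append_leftI)
    moreover have "word_val G_at (map letter w) = word_val G_at v"
      using move_across_tat(3)[OF pq, where e = e and k = k] unfolding v_def move by (rule HOL.sym)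
    ultimately show ?thesis
      using move_across_tat(2,4)[OF pq, where e = e and k = k] unfolding v_def move by blast
  qed
qed

theorem proposition4p5:
  assumes "ord \<in> {[a_G, inv\<^bsub>G_at\<^esub> a_G, t_G], [inv\<^bsub>G_at\<^esub> a_G, a_G, t_G],
                  [t_G, a_G, inv\<^bsub>G_at\<^esub> a_G], [t_G, inv\<^bsub>G_at\<^esub> a_G, a_G]}"
  shows "SL_FFTP G_at {a_G, t_G} (list_order ord)"
proof -
  have "distinct ord" using assms letters_distinct by auto
  then have r: "wf (list_order ord)" "trans (list_order ord)"
    by (rule wf_list_order, rule trans_list_order)
  have len: "length ord = 3" using assms by auto
  have A: "letter (A, e) = a_G \<or> letter (A, e) = inv\<^bsub>G_at\<^esub> a_G" for e
    by (cases e) (simp_all add: letter_simps)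
  \<comment> \<open>The four orders are sorted by whether t comes last or first.\<close>
  have "(\<forall>e. letter (A, e) \<in> {ord ! 0, ord ! 1}) \<and> t_G = ord ! 2 \<or>
    (\<forall>e. letter (A, e) \<in> {ord ! 1, ord ! 2}) \<and> t_G = ord ! 0"
    using assms by (elim insertE emptyE) (use A in \<open>simp_all add: disj_commute\<close>)
  then consider (greatest) "\<And>e. letter (A, e) \<in> {ord ! 0, ord ! 1}" "t_G = ord ! 2"
    | (least) "\<And>e. letter (A, e) \<in> {ord ! 1, ord ! 2}" "t_G = ord ! 0"
    by blast
  then show ?thesis
  proof cases
    case greatest
    have "(letter (A, e), t_G) \<in> list_order ord" for e
      using greatest(1)[of e] nth_list_order[of 0 2 ord] nth_list_order[of 1 2 ord] greatest(2) len
      by auto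
    then show ?thesis by (rule SL_FFTP_t_greatest[OF r])
  next
    case least
    have "(t_G, letter (A, e)) \<in> list_order ord" for e
      using least(1)[of e] nth_list_order[of 0 1 ord] nth_list_order[of 0 2 ord] least(2) len
      by auto
    then show ?thesis by (rule SL_FFTP_t_least[OF r])
  qed
qed

end
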